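(* Let $(A,B)$ be a pair of nonempty, weakly compact and convex subsets of a normed linear space $X$. Let $T:(A\times B)\cup(B\times A)\to A\cup B$ be a $p$-cyclic Kannan nonexpansive mapping. Suppose that $$\|(T(x,y),T(y,x))-(T(T(x,y),T(y,x)),\,T(T(y,x),T(x,y)))\|<\|(x,y)-(T(x,y),T(y,x))\|$$ for all $(x,y)\in(A\times B)\cup(B\times A)$ with $dist(A,B)<\|(x,y)-(T(x,y),T(y,x))\|$. Then $T$ has a coupled best proximity point.
   Context: For nonempty subsets $A,B$ of a normed space $X$, $dist(A,B)=\inf\{\|a-b\|: a\in A,\ b\in B\}$. The space $X\times X$ carries the norm $\|(x,y)\|=\max\{\|x\|,\|y\|\}$. A mapping $T:(A\times B)\cup(B\times A)\to A\cup B$ is a $p$-cyclic Kannan nonexpansive mapping if: (i) $T(A\times B)\subseteq B$ and $T(B\times A)\subseteq A$; (ii) $\|T(x_1,y_1)-T(x_2,y_2)\|\le\frac12\big[\|(x_1,y_1)-(T(x_1,y_1),T(y_1,x_1))\|+\|(x_2,y_2)-(T(x_2,y_2),T(y_2,x_2))\|\big]$ for all $(x_1,y_1),(x_2,y_2)\in(A\times B)\cup(B\times A)$. A point $(a,b)\in A\times B$ is a coupled best proximity point of $T$ if $\|a-T(a,b)\|=dist(A,B)$ and $\|b-T(b,a)\|=dist(A,B)$. *)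

theory Defs
  imports "HOL-Analysis.Analysis"
begin

definition weak_topology :: "'a::real_normed_vector topology" where
  "weak_topology =
     topology_generated_by {blinfun_apply f -` U | (f :: 'a \<Rightarrow>\<^sub>L real) U. open U}"

definition weakly_compact :: "'a::real_normed_vector set \<Rightarrow> bool" where
  "weakly_compact S \<longleftrightarrow> compactin weak_topology S"

(* The instance norm on the product type is the Euclidean combination of the
   component norms; here X \<times> X carries the maximum norm instead. *)
definition max_norm :: "'a::real_normed_vector \<times> 'a \<Rightarrow> real" where
  "max_norm z = max (norm (fst z)) (norm (snd z))"

(* Only the values of T on (A \<times> B) \<union> (B \<times> A) matter. That they lie in A \<union> B
   follows from the two inclusions. *)
definition p_cyclic_Kannan_nonexpansive ::
    "'a::real_normed_vector set \<Rightarrow> 'a set \<Rightarrow> ('a \<times> 'a \<Rightarrow> 'a) \<Rightarrow> bool" where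
  "p_cyclic_Kannan_nonexpansive A B T \<longleftrightarrow>
     T ` (A \<times> B) \<subseteq> B \<and> T ` (B \<times> A) \<subseteq> A \<and>
     (\<forall>(x1, y1) \<in> (A \<times> B) \<union> (B \<times> A). \<forall>(x2, y2) \<in> (A \<times> B) \<union> (B \<times> A).
        norm (T (x1, y1) - T (x2, y2))
          \<le> 1 / 2 * (max_norm ((x1, y1) - (T (x1, y1), T (y1, x1)))
                    + max_norm ((x2, y2) - (T (x2, y2), T (y2, x2)))))"

definition coupled_best_proximity_point ::
    "'a::real_normed_vector set \<Rightarrow> 'a set \<Rightarrow> ('a \<times> 'a \<Rightarrow> 'a) \<Rightarrow> 'a \<times> 'a \<Rightarrow> bool" where
  "coupled_best_proximity_point A B T = (\<lambda>(a, b).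
     a \<in> A \<and> b \<in> B \<and>
     norm (a - T (a, b)) = setdist A B \<and> norm (b - T (b, a)) = setdist A B)"

end

theory Submission
  imports Defs
begin

text \<open>
  Call \<open>r (x, y) = \<parallel>(x, y) - (T (x, y), T (y, x))\<parallel>\<close> (maximum norm) the displacement at \<open>(x, y)\<close>.
  A coupled best proximity point is a point of \<open>A \<times> B\<close> whose displacement is at most
  \<open>setdist A B\<close>, because each component of the displacement joins a point of \<open>A\<close> to a point of
  \<open>B\<close>. The strict inequality in the hypothesis says that \<open>(x, y) \<mapsto> (T (x, y), T (y, x))\<close> lowers
  every displacement above \<open>setdist A B\<close>. It therefore suffices to find sets \<open>K \<subseteq> A\<close> and
  \<open>L \<subseteq> B\<close>, cyclically invariant under \<open>T\<close>, such that the displacement is constant on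
  \<open>K \<times> L\<close>: no displacement can be lowered there, so every point of \<open>K \<times> L\<close> is a solution.

  Weak compactness and Zorn's lemma give a minimal invariant pair \<open>(K, L)\<close> of weakly closed convex
  sets (\<open>exists_minimal_invariant_pair\<close>), and on such a pair the displacement is constant
  (\<open>displacement_constant_on_minimal_pair\<close>). Indeed, let \<open>E\<close> be the set of points of
  \<open>K \<times> L\<close> with displacement at most \<open>\<rho>\<close>, let \<open>L'\<close> be the closed convex hull of the
  values of \<open>T\<close> on \<open>E\<close>, and \<open>K'\<close> that of the values on the transposed set. By the Kannan
  inequality those values lie in balls of radius \<open>(\<rho> + r (u, v)) / 2\<close> around \<open>T (v, u)\<close> and
  \<open>T (u, v)\<close> respectively. Balls are convex and weakly closed, so they contain the hulls too. For
  \<open>(u, v) \<in> K' \<times> L'\<close> this gives \<open>r (u, v) \<le> (\<rho> + r (u, v)) / 2\<close>, hence \<open>r (u, v) \<le> \<rho>\<close>.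
  So \<open>K' \<times> L' \<subseteq> E\<close>, which makes \<open>(K', L')\<close> an invariant pair, and minimality forces
  \<open>(K', L') = (K, L)\<close> as soon as \<open>E\<close> is nonempty.

  The one fact of functional analysis behind this is that norm balls are weakly closed
  (\<open>closedin_weak_cball\<close>). It rests on the existence of norming functionals, obtained from a
  Hahn--Banach theorem whose proof exhibits linear functionals as minimal sublinear ones.
\<close>

section \<open>Minimal elements of ordered families\<close>

text \<open>
  Zorn's lemma turned downwards and stated for an order type class. It serves twice: for real
  functions in the Hahn--Banach theorem, and for pairs of sets, which are ordered componentwise.
\<close>

lemma exists_minimal_in_family:
  fixes S :: "'b::order set"
  assumes "S \<noteq> {}"
    and bound: "\<And>C. \<lbrakk>C \<noteq> {}; C \<subseteq> S; \<And>a b. a \<in> C \<Longrightarrow> b \<in> C \<Longrightarrow> a \<le> b \<or> b \<le> a\<rbrakk>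
             \<Longrightarrow> \<exists>u\<in>S. \<forall>a\<in>C. u \<le> a"
  shows "\<exists>m\<in>S. \<forall>a\<in>S. a \<le> m \<longrightarrow> a = m"
proof (rule predicate_Zorn)
  show "partial_order_on S (relation_of (\<lambda>a b. b \<le> a) S)"
    by (rule partial_order_on_relation_ofI) auto
  show "\<exists>u\<in>S. \<forall>a\<in>C. u \<le> a" if "C \<in> Chains (relation_of (\<lambda>a b. b \<le> a) S)" for C
  proof (cases "C = {}")
    case True
    then show ?thesis using \<open>S \<noteq> {}\<close> by auto
  next
    case False
    have "C \<subseteq> S" and "\<And>a b. a \<in> C \<Longrightarrow> b \<in> C \<Longrightarrow> a \<le> b \<or> b \<le> a"
      using that unfolding Chains_def relation_of_def by auto
    then show ?thesis using bound False by metis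
  qed
qed

section \<open>The Hahn--Banach theorem for sublinear functionals\<close>

definition sublinear :: "('a::real_vector \<Rightarrow> real) \<Rightarrow> bool" where
  "sublinear q \<longleftrightarrow> (\<forall>x y. q (x + y) \<le> q x + q y) \<and> (\<forall>c>0. \<forall>x. q (c *\<^sub>R x) = c * q x)"

lemma sublinear_add: "sublinear q \<Longrightarrow> q (x + y) \<le> q x + q y"
  and sublinear_scale: "sublinear q \<Longrightarrow> c > 0 \<Longrightarrow> q (c *\<^sub>R x) = c * q x"
  by (auto simp: sublinear_def)

lemma sublinear_zero: "sublinear q \<Longrightarrow> q 0 = 0"
  using sublinear_scale[of q 2 0] by simp

lemma sublinear_lower: "sublinear q \<Longrightarrow> - q (- x) \<le> q x"
  using sublinear_add[of q x "-x"] sublinear_zero[of q] by simp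

lemma sublinearI_submultiplicative:
  assumes "\<And>x y. q (x + y) \<le> q x + q y"
    and le: "\<And>c x. c > 0 \<Longrightarrow> q (c *\<^sub>R x) \<le> c * q x"
  shows "sublinear q"
  unfolding sublinear_def
proof (intro conjI allI impI)
  fix c :: real and x :: 'a assume c: "c > 0"
  have "c * q x = c * q (inverse c *\<^sub>R (c *\<^sub>R x))" using c by simp
  also have "\<dots> \<le> c * (inverse c * q (c *\<^sub>R x))"
    using c le[of "inverse c" "c *\<^sub>R x"] by (intro mult_left_mono) auto
  also have "\<dots> = q (c *\<^sub>R x)" using c by simp
  finally show "q (c *\<^sub>R x) = c * q x" using c le[of c x] by simp
qed (use assms in auto)

text \<open>
  For sublinear \<open>q\<close>, the largest sublinear functional below \<open>q\<close> that takes at \<open>- y\<close> a value at most \<open>- q y\<close>,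
  so that every linear functional below it agrees with \<open>q\<close> at \<open>y\<close>.
\<close>

definition slope_minorant :: "('a::real_vector \<Rightarrow> real) \<Rightarrow> 'a \<Rightarrow> 'a \<Rightarrow> real" where
  "slope_minorant q y x = (INF t\<in>{0..}. q (x + t *\<^sub>R y) - t * q y)"

text \<open>The infimum in \<open>slope_minorant\<close> is taken over a set that is bounded below.\<close>

lemma slope_minorant_lower:
  assumes "sublinear q" "t \<ge> 0"
  shows "- q (- x) \<le> q (x + t *\<^sub>R y) - t * q y"
proof -
  have "t * q y = q (t *\<^sub>R y)"
    using assms sublinear_zero[of q] sublinear_scale[of q t y] by (cases "t = 0") auto
  also have "\<dots> \<le> q (x + t *\<^sub>R y) + q (- x)"
    using sublinear_add[OF assms(1), of "x + t *\<^sub>R y" "-x"] by simp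
  finally show ?thesis by simp
qed

lemma slope_minorant_le:
  assumes "sublinear q" "t \<ge> 0"
  shows "slope_minorant q y x \<le> q (x + t *\<^sub>R y) - t * q y"
  unfolding slope_minorant_def
  by (rule cINF_lower) (use assms slope_minorant_lower in \<open>auto intro!: bdd_belowI2\<close>)

lemma slope_minorant_greatest:
  "(\<And>t. t \<ge> 0 \<Longrightarrow> m \<le> q (x + t *\<^sub>R y) - t * q y) \<Longrightarrow> m \<le> slope_minorant q y x"
  unfolding slope_minorant_def by (rule cINF_greatest) auto

lemma sublinear_slope_minorant:
  assumes q: "sublinear q"
  shows "sublinear (slope_minorant q y)"
proof (rule sublinearI_submultiplicative)
  let ?s = "slope_minorant q y"
  fix x z
  have "?s (x + z) - (q (z + t *\<^sub>R y) - t * q y) \<le> ?s x" if t: "t \<ge> 0" for t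
  proof (rule slope_minorant_greatest)
    fix u :: real assume u: "u \<ge> 0"
    have "?s (x + z) \<le> q ((x + z) + (u + t) *\<^sub>R y) - (u + t) * q y"
      using slope_minorant_le[OF q] t u by simp
    also have "(x + z) + (u + t) *\<^sub>R y = (x + u *\<^sub>R y) + (z + t *\<^sub>R y)"
      by (simp add: algebra_simps)
    also have "q \<dots> \<le> q (x + u *\<^sub>R y) + q (z + t *\<^sub>R y)"
      by (rule sublinear_add[OF q])
    finally show "?s (x + z) - (q (z + t *\<^sub>R y) - t * q y) \<le> q (x + u *\<^sub>R y) - u * q y"
      by (simp add: algebra_simps)
  qed
  then have "?s (x + z) - ?s x \<le> ?s z"
    by (intro slope_minorant_greatest) (simp add: algebra_simps)
  then show "?s (x + z) \<le> ?s x + ?s z" by simp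
next
  let ?s = "slope_minorant q y"
  fix c :: real and x assume c: "c > 0"
  have "?s (c *\<^sub>R x) / c \<le> ?s x"
  proof (rule slope_minorant_greatest)
    fix t :: real assume "t \<ge> 0"
    then have "?s (c *\<^sub>R x) \<le> q (c *\<^sub>R x + (c * t) *\<^sub>R y) - (c * t) * q y"
      using c by (intro slope_minorant_le q) simp
    also have "c *\<^sub>R x + (c * t) *\<^sub>R y = c *\<^sub>R (x + t *\<^sub>R y)"
      by (simp add: algebra_simps)
    also have "q \<dots> = c * q (x + t *\<^sub>R y)" by (rule sublinear_scale[OF q c])
    finally show "?s (c *\<^sub>R x) / c \<le> q (x + t *\<^sub>R y) - t * q y"
      using c by (simp add: field_simps)
  qed
  then show "?s (c *\<^sub>R x) \<le> c * ?s x" using c by (simp add: field_simps)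
qed

text \<open>
  Zorn's lemma applies because the pointwise infimum of a chain of sublinear functionals is again
  sublinear; it is finite because \<open>- p (- x)\<close> bounds every sublinear functional below \<open>p\<close> from
  below at \<open>x\<close>.
\<close>

lemma exists_minimal_sublinear_below:
  assumes p: "sublinear p"
  shows "\<exists>q. sublinear q \<and> q \<le> p \<and> (\<forall>s. sublinear s \<longrightarrow> s \<le> q \<longrightarrow> s = q)"
proof -
  let ?S = "{q. sublinear q \<and> q \<le> p}"
  have "\<exists>m\<in>?S. \<forall>a\<in>?S. a \<le> m \<longrightarrow> a = m"
  proof (rule exists_minimal_in_family)
    show "?S \<noteq> {}" using p by auto
  next
    fix C assume ne: "C \<noteq> {}" and sub: "C \<subseteq> ?S"
      and chain: "\<And>a b. a \<in> C \<Longrightarrow> b \<in> C \<Longrightarrow> a \<le> b \<or> b \<le> a"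
    define u where "u x = (INF q\<in>C. q x)" for x
    have lower: "- p (- x) \<le> q x" if "q \<in> C" for q x
    proof -
      have "sublinear q" "q (- x) \<le> p (- x)" using that sub by (auto simp: le_fun_def)
      then show ?thesis using sublinear_lower[of q x] by linarith
    qed
    have u_le: "u x \<le> q x" if "q \<in> C" for q x
      unfolding u_def by (rule cINF_lower) (use that lower in \<open>auto intro!: bdd_belowI2\<close>)
    have u_greatest: "m \<le> u x" if "\<And>q. q \<in> C \<Longrightarrow> m \<le> q x" for m x
      unfolding u_def by (rule cINF_greatest[OF ne]) (use that in auto)
    have "sublinear u"
    proof (rule sublinearI_submultiplicative)
      fix x y
      have "u (x + y) \<le> q x + r y" if qr: "q \<in> C" "r \<in> C" for q r
      proof -
        (* the smaller of the two functionals serves both arguments *)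
        obtain s where s: "s \<in> C" "s \<le> q" "s \<le> r" using chain[OF qr] qr by auto
        have "sublinear s" using s sub by auto
        then have "u (x + y) \<le> s x + s y"
          using u_le[OF s(1)] sublinear_add order_trans by metis
        also have "\<dots> \<le> q x + r y" using s by (intro add_mono) (auto simp: le_fun_def)
        finally show ?thesis .
      qed
      then have "u (x + y) - r y \<le> u x" if "r \<in> C" for r
        by (intro u_greatest) (use that in \<open>simp add: algebra_simps\<close>)
      then have "u (x + y) - u x \<le> u y" by (intro u_greatest) (simp add: algebra_simps)
      then show "u (x + y) \<le> u x + u y" by simp
    next
      fix c :: real and x :: 'a assume c: "c > 0"
      have "u (c *\<^sub>R x) / c \<le> u x"
      proof (rule u_greatest)
        fix q assume q: "q \<in> C"
        then have "u (c *\<^sub>R x) \<le> c * q x"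
          using u_le[OF q, of "c *\<^sub>R x"] sublinear_scale[OF _ c, of q x] sub by auto
        then show "u (c *\<^sub>R x) / c \<le> q x" using c by (simp add: field_simps)
      qed
      then show "u (c *\<^sub>R x) \<le> c * u x" using c by (simp add: field_simps)
    qed
    moreover have "u \<le> p"
    proof -
      obtain q where "q \<in> C" using ne by auto
      then have "u \<le> q" "q \<le> p" using u_le sub by (auto simp: le_fun_def)
      then show ?thesis by (rule order_trans)
    qed
    ultimately show "\<exists>u\<in>?S. \<forall>a\<in>C. u \<le> a" using u_le by (auto simp: le_fun_def)
  qed
  then show ?thesis by (metis (mono_tags, lifting) mem_Collect_eq order_trans)
qed

text \<open>
  A minimal \<open>q\<close> coincides with each of its slope minorants, and the term \<open>t = 1\<close> of the
  infimum then supplies the missing superadditivity \<open>q x + q y \<le> q (x + y)\<close>.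
\<close>

lemma minimal_sublinear_imp_linear:
  assumes q: "sublinear q" and minimal: "\<And>s. sublinear s \<Longrightarrow> s \<le> q \<Longrightarrow> s = q"
  shows "linear q"
proof -
  have add: "q (x + y) = q x + q y" for x y
  proof -
    have "slope_minorant q y \<le> q"
      using slope_minorant_le[OF q, of 0 y] by (auto simp: le_fun_def)
    then have "slope_minorant q y = q" by (intro minimal sublinear_slope_minorant q)
    then have "q x \<le> q (x + y) - q y" using slope_minorant_le[OF q, of 1 y x] by simp
    then show ?thesis using sublinear_add[OF q, of x y] by simp
  qed
  have neg: "q (- x) = - q x" for x
    using add[of x "-x"] sublinear_zero[OF q] by simp
  have "q (c *\<^sub>R x) = c * q x" for c x
  proof -
    consider "c > 0" | "c = 0" | "- c > 0" by linarith
    then show ?thesis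
    proof cases
      case 3
      then show ?thesis using sublinear_scale[OF q 3, of x] neg[of "c *\<^sub>R x"] by simp
    qed (use q sublinear_scale sublinear_zero in auto)
  qed
  then show ?thesis using add by (intro linearI) auto
qed

text \<open>
  The Hahn--Banach theorem: starting the minimisation from the slope minorant in direction
  \<open>z\<close>, and not from \<open>p\<close> itself, fixes the value at \<open>z\<close>.
\<close>

lemma sublinear_supporting_linear:
  assumes p: "sublinear p"
  shows "\<exists>f. linear f \<and> (\<forall>x. f x \<le> p x) \<and> f z = p z"
proof -
  obtain f where f: "sublinear f" "f \<le> slope_minorant p z"
    "\<And>s. sublinear s \<Longrightarrow> s \<le> f \<Longrightarrow> s = f"
    using exists_minimal_sublinear_below[OF sublinear_slope_minorant[OF p]] by metis
  have lin: "linear f" using minimal_sublinear_imp_linear f(1,3) .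
  have below: "f x \<le> p x" for x
    using f(2) slope_minorant_le[OF p, of 0 z x] by (auto simp: le_fun_def intro: order_trans)
  have "f (- z) \<le> slope_minorant p z (- z)" using f(2) by (auto simp: le_fun_def)
  also have "\<dots> \<le> - p z"
    using slope_minorant_le[OF p, of 1 z "-z"] sublinear_zero[OF p] by simp
  finally have "p z \<le> f z" using linear_neg[OF lin] by simp
  with lin below show ?thesis by (intro exI[of _ f]) (auto intro: antisym)
qed

lemma exists_norming_functional:
  fixes z :: "'a::real_normed_vector"
  shows "\<exists>f :: 'a \<Rightarrow>\<^sub>L real. f z = norm z \<and> (\<forall>x. f x \<le> norm x)"
proof -
  have "sublinear (norm :: 'a \<Rightarrow> real)" by (auto simp: sublinear_def norm_triangle_ineq)
  then obtain f :: "'a \<Rightarrow> real"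
    where f: "linear f" "\<And>x. f x \<le> norm x" "f z = norm z"
    using sublinear_supporting_linear by blast
  have "\<bar>f x\<bar> \<le> norm x" for x
    using f(2)[of x] f(2)[of "-x"] linear_neg[OF f(1)] by (auto simp: abs_le_iff)
  then have "bounded_linear f"
    by (intro linear_conv_bounded_linear[THEN iffD1] bounded_linear_intro[of _ 1])
       (use f(1) in \<open>auto simp: linear_add linear_scale\<close>)
  then have "blinfun_apply (Blinfun f) = f" by (rule bounded_linear_Blinfun_apply)
  then show ?thesis using f by (intro exI[of _ "Blinfun f"]) auto
qed

section \<open>Weakly closed convex sets\<close>

lemma topspace_weak_topology [simp]: "topspace weak_topology = UNIV"
proof -
  have "UNIV \<in> {blinfun_apply f -` U | (f :: 'a \<Rightarrow>\<^sub>L real) U. open U}"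
    by (rule CollectI) (metis open_UNIV vimage_UNIV)
  then show ?thesis
    unfolding weak_topology_def topology_generated_by_topspace by blast
qed

lemma closedin_weak_halfspace:
  fixes f :: "'a::real_normed_vector \<Rightarrow>\<^sub>L real"
  shows "closedin weak_topology {x. f x \<le> c}"
proof -
  have "blinfun_apply f -` {c<..} \<in> {blinfun_apply g -` U | (g :: 'a \<Rightarrow>\<^sub>L real) U. open U}"
    by (intro CollectI exI conjI) (rule refl, rule open_greaterThan)
  then have "openin weak_topology (blinfun_apply f -` {c<..})"
    unfolding weak_topology_def by (rule topology_generated_by_Basis)
  moreover have "UNIV - {x. f x \<le> c} = blinfun_apply f -` {c<..}" by auto
  ultimately show ?thesis by (simp add: closedin_def)
qed

text \<open>
  A ball is an intersection of half-spaces: a norming functional of \<open>x - w\<close> separates any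
  point \<open>x\<close> outside the ball from it.
\<close>

lemma closedin_weak_cball:
  fixes w :: "'a::real_normed_vector"
  shows "closedin weak_topology (cball w \<rho>)"
proof -
  let ?\<F> = "{{x. f x \<le> f w + \<rho>} | f :: 'a \<Rightarrow>\<^sub>L real. \<forall>x. f x \<le> norm x}"
  have "cball w \<rho> = \<Inter>?\<F>"
  proof (intro equalityI subsetI)
    fix x assume "x \<in> cball w \<rho>"
    then have x: "norm (x - w) \<le> \<rho>" by (simp add: dist_norm norm_minus_commute)
    have "f x \<le> f w + \<rho>" if "\<forall>x. f x \<le> norm x" for f :: "'a \<Rightarrow>\<^sub>L real"
      using that[rule_format, of "x - w"] x by (simp add: blinfun.diff_right)
    then show "x \<in> \<Inter>?\<F>" by blast
  next
    fix x assume x: "x \<in> \<Inter>?\<F>"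
    obtain f :: "'a \<Rightarrow>\<^sub>L real"
      where f: "f (x - w) = norm (x - w)" "\<forall>x. f x \<le> norm x"
      using exists_norming_functional by blast
    from x f(2) have "f x \<le> f w + \<rho>" by blast
    then show "x \<in> cball w \<rho>"
      using f(1) by (simp add: blinfun.diff_right dist_norm norm_minus_commute)
  qed
  moreover have "closedin weak_topology (\<Inter>?\<F>)"
  proof (rule closedin_Inter)
    show "?\<F> \<noteq> {}" using exists_norming_functional[of 0] by blast
  qed (use closedin_weak_halfspace in blast)
  ultimately show ?thesis by simp
qed

text \<open>
  Closedness is taken relative to \<open>A\<close>, so that \<open>A\<close> itself qualifies without an appeal to
  the Hausdorff property of the weak topology.
\<close>

definition closed_convex_in :: "'a::real_normed_vector set \<Rightarrow> 'a set \<Rightarrow> bool" where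
  "closed_convex_in A K \<longleftrightarrow> closedin (subtopology weak_topology A) K \<and> convex K"

lemma closed_convex_in_subset: "closed_convex_in A K \<Longrightarrow> K \<subseteq> A"
  unfolding closed_convex_in_def
  using closedin_subset[of "subtopology weak_topology A" K] by (simp add: topspace_subtopology)

lemma closed_convex_in_self: "convex A \<Longrightarrow> closed_convex_in A A"
  unfolding closed_convex_in_def
  using closedin_topspace[of "subtopology weak_topology A"] by (simp add: topspace_subtopology)

lemma closed_convex_in_Inter:
  assumes "\<K> \<noteq> {}" and "\<And>K. K \<in> \<K> \<Longrightarrow> closed_convex_in A K"
  shows "closed_convex_in A (\<Inter>\<K>)"
  unfolding closed_convex_in_def
proof
  show "closedin (subtopology weak_topology A) (\<Inter>\<K>)"
    by (rule closedin_Inter) (use assms in \<open>auto simp: closed_convex_in_def\<close>)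
  show "convex (\<Inter>\<K>)"
    by (rule convex_Inter) (use assms in \<open>simp add: closed_convex_in_def\<close>)
qed

lemma closed_convex_in_cball:
  assumes "convex A"
  shows "closed_convex_in A (A \<inter> cball w \<rho>)"
  unfolding closed_convex_in_def
  by (intro conjI closedin_subtopology_Int_closed closedin_weak_cball convex_Int assms convex_cball)

lemma weakly_compact_chain_Inter_nonempty:
  assumes "weakly_compact A" and "\<K> \<noteq> {}"
    and clo: "\<And>K. K \<in> \<K> \<Longrightarrow> closed_convex_in A K" and ne: "\<And>K. K \<in> \<K> \<Longrightarrow> K \<noteq> {}"
    and chain: "\<And>K L. K \<in> \<K> \<Longrightarrow> L \<in> \<K> \<Longrightarrow> K \<subseteq> L \<or> L \<subseteq> K"
  shows "\<Inter>\<K> \<noteq> {}"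
proof -
  have "compact_space (subtopology weak_topology A)"
    using assms(1) unfolding weakly_compact_def by (rule compact_space_subtopology)
  moreover have "\<forall>K\<in>\<K>. closedin (subtopology weak_topology A) K"
    using clo by (simp add: closed_convex_in_def)
  moreover have "\<forall>\<F>. finite \<F> \<longrightarrow> \<F> \<subseteq> \<K> \<longrightarrow> \<Inter>\<F> \<noteq> {}"
  proof (intro allI impI)
    fix \<F> assume "finite \<F>" "\<F> \<subseteq> \<K>"
    show "\<Inter>\<F> \<noteq> {}"
    proof (cases "\<F> = {}")
      case False
      then obtain M where M: "M \<in> \<F>" "\<And>K. K \<in> \<F> \<Longrightarrow> K \<subseteq> M \<Longrightarrow> K = M"
        using finite_has_minimal[OF \<open>finite \<F>\<close> False] by metis
      have "M \<subseteq> K" if "K \<in> \<F>" for K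
        using chain[of K M] M that \<open>\<F> \<subseteq> \<K>\<close> by auto
      then have "M \<subseteq> \<Inter>\<F>" by (rule Inter_greatest)
      moreover have "M \<noteq> {}" using ne M(1) \<open>\<F> \<subseteq> \<K>\<close> by auto
      ultimately show ?thesis by auto
    qed simp
  qed
  ultimately show ?thesis by (simp add: compact_space_fip)
qed

definition closed_convex_hull_in :: "'a::real_normed_vector set \<Rightarrow> 'a set \<Rightarrow> 'a set" where
  "closed_convex_hull_in A M = \<Inter>{K. closed_convex_in A K \<and> M \<subseteq> K}"

lemma closed_convex_hull_in_superset: "M \<subseteq> closed_convex_hull_in A M"
  unfolding closed_convex_hull_in_def by blast

lemma closed_convex_hull_in_least:
  "closed_convex_in A K \<Longrightarrow> M \<subseteq> K \<Longrightarrow> closed_convex_hull_in A M \<subseteq> K"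
  unfolding closed_convex_hull_in_def by blast

lemma closed_convex_in_hull:
  assumes "convex A" "M \<subseteq> A"
  shows "closed_convex_in A (closed_convex_hull_in A M)"
  unfolding closed_convex_hull_in_def
proof (rule closed_convex_in_Inter)
  show "{K. closed_convex_in A K \<and> M \<subseteq> K} \<noteq> {}"
    using closed_convex_in_self[OF assms(1)] assms(2) by blast
qed simp

text \<open>
  This is how a norm estimate on a set of values passes to the hull: the part of the ball inside
  \<open>A\<close> is one of the sets being intersected.
\<close>

lemma closed_convex_hull_in_cball:
  assumes "convex A" "M \<subseteq> A" "M \<subseteq> cball w \<rho>"
  shows "closed_convex_hull_in A M \<subseteq> cball w \<rho>"
  using closed_convex_hull_in_least[OF closed_convex_in_cball[OF assms(1)], of M w \<rho>] assms
  by blast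

section \<open>Minimal cyclically invariant pairs\<close>

definition invariant_pair ::
  "'a::real_normed_vector set \<Rightarrow> 'a set \<Rightarrow> ('a \<times> 'a \<Rightarrow> 'a) \<Rightarrow> 'a set \<times> 'a set \<Rightarrow> bool" where
  "invariant_pair A B T = (\<lambda>(K, L). closed_convex_in A K \<and> closed_convex_in B L \<and>
     K \<noteq> {} \<and> L \<noteq> {} \<and> T ` (K \<times> L) \<subseteq> L \<and> T ` (L \<times> K) \<subseteq> K)"

lemma exists_minimal_invariant_pair:
  assumes wc: "weakly_compact A" "weakly_compact B" and inv: "invariant_pair A B T (A, B)"
  shows "\<exists>K L. invariant_pair A B T (K, L) \<and>
    (\<forall>K' L'. invariant_pair A B T (K', L') \<longrightarrow> K' \<subseteq> K \<longrightarrow> L' \<subseteq> L \<longrightarrow> K' = K \<and> L' = L)"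
proof -
  let ?S = "Collect (invariant_pair A B T)"
  have "\<exists>m\<in>?S. \<forall>a\<in>?S. a \<le> m \<longrightarrow> a = m"
  proof (rule exists_minimal_in_family)
    show "?S \<noteq> {}" using inv by blast
  next
    fix C assume ne: "C \<noteq> {}" and sub: "C \<subseteq> ?S"
      and chain: "\<And>a b. a \<in> C \<Longrightarrow> b \<in> C \<Longrightarrow> a \<le> b \<or> b \<le> a"
    have C: "closed_convex_in A (fst P)" "closed_convex_in B (snd P)" "fst P \<noteq> {}" "snd P \<noteq> {}"
        "T ` (fst P \<times> snd P) \<subseteq> snd P" "T ` (snd P \<times> fst P) \<subseteq> fst P" if "P \<in> C" for P
    proof -
      have "invariant_pair A B T (fst P, snd P)" using that sub by auto
      then show "closed_convex_in A (fst P)" "closed_convex_in B (snd P)" "fst P \<noteq> {}" "snd P \<noteq> {}"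
        "T ` (fst P \<times> snd P) \<subseteq> snd P" "T ` (snd P \<times> fst P) \<subseteq> fst P"
        unfolding invariant_pair_def prod.case by (simp_all only: simp_thms)
    qed
    let ?K = "\<Inter>(fst ` C)" and ?L = "\<Inter>(snd ` C)"
    have "?K \<noteq> {}"
    proof (rule weakly_compact_chain_Inter_nonempty[OF wc(1)])
      fix K L assume "K \<in> fst ` C" "L \<in> fst ` C"
      then show "K \<subseteq> L \<or> L \<subseteq> K" using chain by (fastforce simp: less_eq_prod_def)
    qed (use ne C in auto)
    moreover have "?L \<noteq> {}"
    proof (rule weakly_compact_chain_Inter_nonempty[OF wc(2)])
      fix K L assume "K \<in> snd ` C" "L \<in> snd ` C"
      then show "K \<subseteq> L \<or> L \<subseteq> K" using chain by (fastforce simp: less_eq_prod_def)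
    qed (use ne C in auto)
    moreover have "closed_convex_in A ?K" "closed_convex_in B ?L"
      by (rule closed_convex_in_Inter; use ne C in auto)+
    moreover have "T ` (?K \<times> ?L) \<subseteq> ?L" "T ` (?L \<times> ?K) \<subseteq> ?K"
    proof -
      show "T ` (?K \<times> ?L) \<subseteq> ?L"
      proof safe
        fix x y P assume "x \<in> ?K" "y \<in> ?L" and P: "P \<in> C"
        then have "(x, y) \<in> fst P \<times> snd P" by blast
        then show "T (x, y) \<in> snd P" using C(5)[OF P] by blast
      qed
      show "T ` (?L \<times> ?K) \<subseteq> ?K"
      proof safe
        fix x y P assume "x \<in> ?L" "y \<in> ?K" and P: "P \<in> C"
        then have "(x, y) \<in> snd P \<times> fst P" by blast
        then show "T (x, y) \<in> fst P" using C(6)[OF P] by blast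
      qed
    qed
    ultimately have "invariant_pair A B T (?K, ?L)" by (simp add: invariant_pair_def)
    moreover have "(?K, ?L) \<le> P" if "P \<in> C" for P
      using that by (auto simp: less_eq_prod_def)
    ultimately show "\<exists>u\<in>?S. \<forall>a\<in>C. u \<le> a" by blast
  qed
  then obtain P where P: "invariant_pair A B T P"
    and least: "\<And>Q. invariant_pair A B T Q \<Longrightarrow> Q \<le> P \<Longrightarrow> Q = P"
    by blast
  obtain K L where KL: "P = (K, L)" by (cases P)
  have "K' = K \<and> L' = L" if "invariant_pair A B T (K', L')" "K' \<subseteq> K" "L' \<subseteq> L" for K' L'
    using least[OF that(1)] that(2,3) by (simp add: KL less_eq_prod_def)
  with P[unfolded KL] show ?thesis by blast
qed

section \<open>Constancy of the displacement on a minimal pair\<close>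

definition displacement :: "('a::real_normed_vector \<times> 'a \<Rightarrow> 'a) \<Rightarrow> 'a \<Rightarrow> 'a \<Rightarrow> real" where
  "displacement T x y = max_norm ((x, y) - (T (x, y), T (y, x)))"

lemma displacement_eq: "displacement T x y = max (norm (x - T (x, y))) (norm (y - T (y, x)))"
  by (simp add: displacement_def max_norm_def)

lemma displacement_commute: "displacement T y x = displacement T x y"
  by (simp add: displacement_eq max.commute)

text \<open>
  Any displacement attained on a minimal pair is an upper bound for all the others, so the
  displacement is constant. The bound is a self-improving estimate: on the hulls of the values of
  \<open>T\<close> over the sublevel set \<open>E\<close>, the Kannan inequality bounds the displacement by the mean of
  \<open>\<rho>\<close> and itself.
\<close>

lemma displacement_constant_on_minimal_pair:
  assumes cvx: "convex A" "convex B"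
    and kannan: "p_cyclic_Kannan_nonexpansive A B T"
    and KL: "invariant_pair A B T (K, L)"
    and minimal: "\<And>K' L'. \<lbrakk>invariant_pair A B T (K', L'); K' \<subseteq> K; L' \<subseteq> L\<rbrakk> \<Longrightarrow> K' = K \<and> L' = L"
    and ab: "a \<in> K" "b \<in> L" and xy: "x \<in> K" "y \<in> L"
  shows "displacement T x y \<le> displacement T a b"
proof -
  have clo: "closed_convex_in A K" "closed_convex_in B L"
    and inv: "T ` (K \<times> L) \<subseteq> L" "T ` (L \<times> K) \<subseteq> K"
    using KL by (auto simp: invariant_pair_def)
  have sub: "K \<subseteq> A" "L \<subseteq> B" using clo closed_convex_in_subset by auto
  have contr: "norm (T (u, v) - T (u', v')) \<le> (displacement T u v + displacement T u' v') / 2"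
    if "(u, v) \<in> (A \<times> B) \<union> (B \<times> A)" "(u', v') \<in> (A \<times> B) \<union> (B \<times> A)" for u v u' v'
  proof -
    have "\<forall>(x1, y1) \<in> (A \<times> B) \<union> (B \<times> A). \<forall>(x2, y2) \<in> (A \<times> B) \<union> (B \<times> A).
        norm (T (x1, y1) - T (x2, y2)) \<le> 1 / 2 * (displacement T x1 y1 + displacement T x2 y2)"
      using kannan unfolding p_cyclic_Kannan_nonexpansive_def displacement_def by blast
    from bspec[OF this[THEN bspec, OF that(1), unfolded prod.case] that(2)] show ?thesis by simp
  qed
  define \<rho> where "\<rho> = displacement T a b"
  define E where "E = {(x, y). x \<in> K \<and> y \<in> L \<and> displacement T x y \<le> \<rho>}"
  let ?VK = "{T (v, u) | u v. (u, v) \<in> E}" and ?VL = "T ` E"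
  define K' where "K' = closed_convex_hull_in A ?VK"
  define L' where "L' = closed_convex_hull_in B ?VL"
  have VK: "?VK \<subseteq> K" and VL: "?VL \<subseteq> L"
    using inv unfolding E_def by (auto simp: image_subset_iff)
  have K'K: "K' \<subseteq> K" and L'L: "L' \<subseteq> L"
    unfolding K'_def L'_def
    by (rule closed_convex_hull_in_least[OF clo(1) VK],
        rule closed_convex_hull_in_least[OF clo(2) VL])
  have disp: "displacement T u v \<le> \<rho>" if uv: "u \<in> K'" "v \<in> L'" for u v
  proof -
    let ?d = "(\<rho> + displacement T u v) / 2"
    have mem: "u \<in> A" "v \<in> B" using uv K'K L'L sub by auto
    have "?VK \<subseteq> cball (T (u, v)) ?d"
    proof (safe)
      fix s t assume "(s, t) \<in> E"
      then have st: "s \<in> A" "t \<in> B" "displacement T t s \<le> \<rho>"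
        using sub displacement_commute[of T t s] by (auto simp: E_def)
      then have "norm (T (u, v) - T (t, s)) \<le> (displacement T u v + displacement T t s) / 2"
        using contr mem by simp
      then show "T (t, s) \<in> cball (T (u, v)) ?d"
        using st(3) by (simp add: dist_norm)
    qed
    then have "K' \<subseteq> cball (T (u, v)) ?d"
      unfolding K'_def using VK sub cvx by (intro closed_convex_hull_in_cball) auto
    then have 1: "norm (u - T (u, v)) \<le> ?d"
      using uv by (auto simp: dist_norm norm_minus_commute)
    have "?VL \<subseteq> cball (T (v, u)) ?d"
    proof (safe)
      fix s t assume "(s, t) \<in> E"
      then have st: "s \<in> A" "t \<in> B" "displacement T s t \<le> \<rho>"
        using sub by (auto simp: E_def)
      then have "norm (T (v, u) - T (s, t)) \<le> (displacement T v u + displacement T s t) / 2"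
        using contr mem by simp
      then show "T (s, t) \<in> cball (T (v, u)) ?d"
        using st(3) displacement_commute[of T v u] by (simp add: dist_norm)
    qed
    then have "L' \<subseteq> cball (T (v, u)) ?d"
      unfolding L'_def using VL sub cvx by (intro closed_convex_hull_in_cball) auto
    then have 2: "norm (v - T (v, u)) \<le> ?d"
      using uv by (auto simp: dist_norm norm_minus_commute)
    have "displacement T u v \<le> ?d" using 1 2 by (subst displacement_eq) simp
    then show ?thesis by simp
  qed
  then have E': "K' \<times> L' \<subseteq> E" using K'K L'L by (auto simp: E_def)
  have "invariant_pair A B T (K', L')"
    unfolding invariant_pair_def prod.case
  proof (intro conjI)
    show "closed_convex_in A K'" "closed_convex_in B L'"
      unfolding K'_def L'_def using VK VL sub cvx by (auto intro!: closed_convex_in_hull)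
    have "(a, b) \<in> E" using ab by (simp add: E_def \<rho>_def)
    then have "T (b, a) \<in> ?VK" "T (a, b) \<in> ?VL" by blast+
    then have "T (b, a) \<in> K'" "T (a, b) \<in> L'"
      unfolding K'_def L'_def by (auto intro!: closed_convex_hull_in_superset[THEN subsetD])
    then show "K' \<noteq> {}" "L' \<noteq> {}" by auto
    have "T ` (K' \<times> L') \<subseteq> ?VL" using E' by blast
    also have "\<dots> \<subseteq> L'" unfolding L'_def by (rule closed_convex_hull_in_superset)
    finally show "T ` (K' \<times> L') \<subseteq> L'" .
    have "T ` (L' \<times> K') \<subseteq> ?VK" using E' by blast
    also have "\<dots> \<subseteq> K'" unfolding K'_def by (rule closed_convex_hull_in_superset)
    finally show "T ` (L' \<times> K') \<subseteq> K'" .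
  qed
  then have "K' = K" "L' = L" using minimal K'K L'L by blast+
  then show ?thesis using disp xy by (simp add: \<rho>_def)
qed

section \<open>Coupled best proximity points\<close>

theorem theorem2p13:
  fixes A B :: "'a::real_normed_vector set" and T :: "'a \<times> 'a \<Rightarrow> 'a"
  assumes "A \<noteq> {}" and "weakly_compact A" and "convex A"
    and "B \<noteq> {}" and "weakly_compact B" and "convex B"
    and "p_cyclic_Kannan_nonexpansive A B T"
    and "\<And>x y. (x, y) \<in> (A \<times> B) \<union> (B \<times> A) \<Longrightarrow>
           setdist A B < max_norm ((x, y) - (T (x, y), T (y, x))) \<Longrightarrow>
           max_norm ((T (x, y), T (y, x))
                      - (T (T (x, y), T (y, x)), T (T (y, x), T (x, y))))
             < max_norm ((x, y) - (T (x, y), T (y, x)))"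
  shows "\<exists>p. coupled_best_proximity_point A B T p"
proof -
  have maps: "T ` (A \<times> B) \<subseteq> B" "T ` (B \<times> A) \<subseteq> A"
    using assms(7) unfolding p_cyclic_Kannan_nonexpansive_def by auto
  then have "invariant_pair A B T (A, B)"
    using assms(1,3,4,6) by (simp add: invariant_pair_def closed_convex_in_self)
  then obtain K L where KL: "invariant_pair A B T (K, L)"
    and minimal: "\<And>K' L'. \<lbrakk>invariant_pair A B T (K', L'); K' \<subseteq> K; L' \<subseteq> L\<rbrakk> \<Longrightarrow> K' = K \<and> L' = L"
    using exists_minimal_invariant_pair[OF assms(2,5)] by metis
  have KL_props: "K \<subseteq> A" "L \<subseteq> B" "K \<noteq> {}" "L \<noteq> {}" "T ` (K \<times> L) \<subseteq> L" "T ` (L \<times> K) \<subseteq> K"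
    using KL closed_convex_in_subset by (auto simp: invariant_pair_def)
  obtain a b where ab: "a \<in> K" "b \<in> L" using KL_props(3,4) by blast
  have img: "T (a, b) \<in> L" "T (b, a) \<in> K"
    using ab KL_props(5,6) unfolding image_subset_iff by simp_all
  have AB: "a \<in> A" "b \<in> B" using ab KL_props(1,2) by auto
  (* The image (T (a, b), T (b, a)) lies in L \<times> K; its transpose has the same displacement
     and lies in K \<times> L, where the displacement is constant. *)
  have "displacement T a b \<le> displacement T (T (b, a)) (T (a, b))"
    using displacement_constant_on_minimal_pair[OF assms(3,6,7) KL minimal img(2,1) ab] .
  also have "\<dots> = displacement T (T (a, b)) (T (b, a))" by (rule displacement_commute)
  finally have "\<not> setdist A B < displacement T a b"
    using assms(8)[of a b] AB unfolding displacement_def by auto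
  then have "norm (a - T (a, b)) \<le> setdist A B" "norm (b - T (b, a)) \<le> setdist A B"
    by (auto simp: displacement_eq)
  moreover have "setdist A B \<le> norm (a - T (a, b))"
    using setdist_le_dist[of a A "T (a, b)" B] AB img KL_props by (auto simp: dist_norm)
  moreover have "setdist A B \<le> norm (b - T (b, a))"
    using setdist_le_dist[of "T (b, a)" A b B] AB img KL_props
    by (auto simp: dist_norm norm_minus_commute)
  ultimately have "coupled_best_proximity_point A B T (a, b)"
    using AB by (simp add: coupled_best_proximity_point_def)
  then show ?thesis by blast
qed

end
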